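(* Let $k\ge 2$ be a fixed integer. For every function $\omega(n)$ with $\omega(n)\to\infty$ as $n\to\infty$, for all sufficiently large $n$, $$\frac{1}{\omega(n)}2^{-n/2}n^{-k}\le p_c(Q_{n,k},2)\le \omega(n)2^{-n/2}n^{-k}.$$
   Context: $Q_{n,k}$ is the graph with vertex set $\{0,1\}^n$ in which $x,y$ are adjacent iff $1\le d_H(x,y)\le k$ ($d_H$ = Hamming distance). The $r$-neighbor bootstrap percolation process from $\mathcal{A}_0\subset V$: $\mathcal{A}_i=\mathcal{A}_{i-1}\cup\{v: |N_v\cap\mathcal{A}_{i-1}|\ge r\}$, where $N_v$ is the neighborhood of $v$; it percolates if $\mathcal{A}_i=V$ for some $i$. In the random setting each vertex is placed in $\mathcal{A}_0$ independently with probability $p$, and the critical probability is $p_c(G,r)=\sup\{p\in(0,1): \mathbb{P}_p(\mathcal{A}_0 \text{ percolates on } G)\le 1/2\}$. The function $\omega(n)$ is an arbitrarily slowly growing function tending to infinity. *)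

theory Defs
  imports "HOL-Probability.Probability" "Graph_Theory.Pair_Digraph"
begin

text \<open>Graphs are symmetric loop-free \<open>pair_pre_digraph\<close>s, i.e. every edge is
  present in both directions.\<close>

definition hamming_dist :: "'a list \<Rightarrow> 'a list \<Rightarrow> nat" where
  "hamming_dist x y = card {i. i < length x \<and> x ! i \<noteq> y ! i}"

definition cube :: "nat \<Rightarrow> bool list set" where
  "cube n = {x. length x = n}"

definition Q :: "nat \<Rightarrow> nat \<Rightarrow> bool list pair_pre_digraph" where
  "Q n k = \<lparr> pverts = cube n,
     parcs = {(x, y). x \<in> cube n \<and> y \<in> cube n \<and>
                      1 \<le> hamming_dist x y \<and> hamming_dist x y \<le> k} \<rparr>"

definition neighborhood :: "'a pair_pre_digraph \<Rightarrow> 'a \<Rightarrow> 'a set" where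
  "neighborhood G v = {u. (v, u) \<in> parcs G}"

fun bootstrap :: "'a pair_pre_digraph \<Rightarrow> nat \<Rightarrow> 'a set \<Rightarrow> nat \<Rightarrow> 'a set" where
  "bootstrap G r A 0 = A"
| "bootstrap G r A (Suc i) = bootstrap G r A i \<union>
     {v \<in> pverts G. card (neighborhood G v \<inter> bootstrap G r A i) \<ge> r}"

definition percolates :: "'a pair_pre_digraph \<Rightarrow> nat \<Rightarrow> 'a set \<Rightarrow> bool" where
  "percolates G r A \<longleftrightarrow> (\<exists>i. bootstrap G r A i = pverts G)"

text \<open>The \<open>p\<close>-random vertex subset of a finite graph: \<open>Pi_pmf\<close> is the product of
  independent Bernoulli indicators over the vertices (the argument \<open>False\<close> is only the
  value outside the vertex set).\<close>

definition random_vertex_set :: "'a pair_pre_digraph \<Rightarrow> real \<Rightarrow> 'a set pmf" where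
  "random_vertex_set G p =
     map_pmf (\<lambda>f. {v \<in> pverts G. f v}) (Pi_pmf (pverts G) False (\<lambda>_. bernoulli_pmf p))"

text \<open>For a finite nonempty graph and \<open>r \<ge> 1\<close> the set below is nonempty, because the
  percolation probability tends to \<open>0\<close> as \<open>p\<close> does; so the real supremum is a genuine one.\<close>

definition critical_prob :: "'a pair_pre_digraph \<Rightarrow> nat \<Rightarrow> real" where
  "critical_prob G r =
     Sup {p \<in> {0<..<1}. measure_pmf.prob (random_vertex_set G p) {A. percolates G r A} \<le> 1/2}"

lemma finite_cube: "finite (cube n)"
  using finite_lists_length_eq[of "UNIV :: bool set" n] by (simp add: cube_def)

lemma hamming_dist_sym: "length x = length y \<Longrightarrow> hamming_dist x y = hamming_dist y x"
  unfolding hamming_dist_def by (intro arg_cong[where f = card]) auto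

lemma pair_graph_Q: "pair_graph (Q n k)"
proof unfold_locales
  show "finite (pverts (Q n k))"
    by (simp add: Q_def finite_cube)
  have "parcs (Q n k) \<subseteq> cube n \<times> cube n"
    by (auto simp: Q_def)
  then show "finite (parcs (Q n k))"
    by (rule finite_subset) (simp add: finite_cube)
  show "symmetric (with_proj (Q n k))"
    by (auto simp: symmetric_def arcs_ends_def arc_to_ends_def Q_def cube_def sym_def
        hamming_dist_sym image_iff)
qed (auto simp: Q_def hamming_dist_def)

end

theory Submission
  imports Defs "HOL-Real_Asymp.Real_Asymp"
begin

text \<open>Percolation is governed by the presence of a close pair in the initial set. Without two
  infected vertices at distance between \<open>1\<close> and \<open>2 * k\<close> nothing new is ever infected, and by a union
  bound such a pair is unlikely once \<open>2 ^ n * n ^ (2 * k) * p\<^sup>2\<close> is small. Conversely, a single pair at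
  distance exactly \<open>2 * k\<close> infects the whole cube, and the second moment method shows that such a pair
  is likely once \<open>2 ^ n * n ^ (2 * k) * p\<^sup>2\<close> is large. The latter bound holds for every \<open>p\<close> above the
  threshold at once, so monotonicity of the percolation probability in \<open>p\<close> is not used.\<close>

section \<open>Random vertex sets\<close>

text \<open>Containing \<open>T\<close> is a product event: the coordinates in \<open>T\<close> are
  forced to be \<open>True\<close> and the others are free, so independence applies.\<close>

lemma prob_subset_random_vertex_set:
  assumes "finite (pverts G)" "T \<subseteq> pverts G" "0 \<le> p" "p \<le> 1"
  shows "measure_pmf.prob (random_vertex_set G p) {A. T \<subseteq> A} = p ^ card T"
proof -
  let ?V = "pverts G"
  have "measure_pmf.prob (random_vertex_set G p) {A. T \<subseteq> A} =
      measure_pmf.prob (Pi_pmf ?V False (\<lambda>_. bernoulli_pmf p))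
        (Pi ?V (\<lambda>x. if x \<in> T then {True} else UNIV))"
    unfolding random_vertex_set_def measure_map_pmf
    by (intro arg_cong2[where f = measure_pmf.prob] refl) (use assms(2) in \<open>auto simp: Pi_def\<close>)
  also have "\<dots> = (\<Prod>x\<in>?V. measure_pmf.prob (bernoulli_pmf p) (if x \<in> T then {True} else UNIV))"
    by (rule measure_Pi_pmf_Pi[OF assms(1)])
  also have "\<dots> = (\<Prod>x\<in>?V. if x \<in> T then p else 1)"
    by (intro prod.cong refl) (use assms in \<open>auto simp: measure_pmf_single\<close>)
  also have "\<dots> = (\<Prod>x\<in>T. p)"
    using assms by (intro prod.mono_neutral_cong_right) auto
  finally show ?thesis by simp
qed

lemma set_pmf_random_vertex_set: "set_pmf (random_vertex_set G p) \<subseteq> Pow (pverts G)"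
  by (auto simp: random_vertex_set_def)

text \<open>Chebyshev's inequality for the number \<open>X\<close> of events \<open>S i\<close> that
  occur: if none occurs, \<open>X\<close> is off its mean \<open>\<mu>\<close> by exactly
  \<open>\<mu>\<close>. The right-hand side is the variance of \<open>X\<close> over
  \<open>\<mu>\<^sup>2\<close>; finite support settles integrability.\<close>

lemma prob_avoid_le_second_moment:
  fixes M :: "'a pmf" and S :: "'i \<Rightarrow> 'a set"
  assumes "finite (set_pmf M)"
    and \<mu>: "\<mu> = (\<Sum>i\<in>I. measure_pmf.prob M (S i))" "\<mu> > 0"
  shows "measure_pmf.prob M {a. \<forall>i\<in>I. a \<notin> S i} \<le>
    (\<Sum>i\<in>I. \<Sum>j\<in>I. measure_pmf.prob M (S i \<inter> S j)) / \<mu>\<^sup>2 - 1"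
proof -
  define X :: "'a \<Rightarrow> real" where "X a = (\<Sum>i\<in>I. indicator (S i) a)" for a
  note [simp] = integrable_measure_pmf_finite[OF assms(1)]
  have EX: "measure_pmf.expectation M X = \<mu>"
    unfolding X_def \<mu> by (subst Bochner_Integration.integral_sum) auto
  have "(X a)\<^sup>2 = (\<Sum>i\<in>I. \<Sum>j\<in>I. indicator (S i \<inter> S j) a)" for a
    by (simp add: X_def power2_eq_square sum_product indicator_inter_arith)
  then have EX2: "measure_pmf.expectation M (\<lambda>a. (X a)\<^sup>2) =
      (\<Sum>i\<in>I. \<Sum>j\<in>I. measure_pmf.prob M (S i \<inter> S j))"
    by (simp add: Bochner_Integration.integral_sum)
  have "measure_pmf.prob M {a. \<forall>i\<in>I. a \<notin> S i} \<le>
      measure_pmf.prob M {a \<in> space M. \<mu> \<le> \<bar>X a - measure_pmf.expectation M X\<bar>}"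
    using \<mu>(2) by (intro measure_pmf.finite_measure_mono) (auto simp: EX, simp add: X_def)
  also have "\<dots> \<le> measure_pmf.variance M X / \<mu>\<^sup>2"
    by (intro measure_pmf.Chebyshev_inequality) (use \<mu>(2) in auto)
  also have "measure_pmf.variance M X = measure_pmf.expectation M (\<lambda>a. (X a)\<^sup>2) - \<mu>\<^sup>2"
    by (subst measure_pmf.variance_eq) (auto simp: EX)
  finally show ?thesis
    using \<mu>(2) by (simp add: EX2 diff_divide_distrib)
qed

text \<open>Union bound over ordered pairs. Irreflexivity makes the two vertices distinct, whence
  the factor \<open>p\<^sup>2\<close>.\<close>

lemma prob_contains_pair_le:
  fixes p :: real
  assumes "finite (pverts G)" "R \<subseteq> pverts G \<times> pverts G" "irrefl R" "0 \<le> p" "p \<le> 1"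
  shows "measure_pmf.prob (random_vertex_set G p) {A. \<exists>(x, y)\<in>R. x \<in> A \<and> y \<in> A} \<le> card R * p\<^sup>2"
proof -
  have fin: "finite R"
    using assms(1,2) by (auto intro: finite_subset)
  have eq: "{A. \<exists>(x, y)\<in>R. x \<in> A \<and> y \<in> A} = (\<Union>(x, y)\<in>R. {A. {x, y} \<subseteq> A})"
    by auto
  have "measure_pmf.prob (random_vertex_set G p) (\<Union>(x, y)\<in>R. {A. {x, y} \<subseteq> A}) \<le>
      (\<Sum>(x, y)\<in>R. measure_pmf.prob (random_vertex_set G p) {A. {x, y} \<subseteq> A})"
    using measure_pmf.finite_measure_subadditive_finite[OF fin,
        of "\<lambda>(x, y). {A. {x, y} \<subseteq> A}" "random_vertex_set G p"]
    by (simp add: case_prod_unfold)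
  also have "\<dots> = (\<Sum>e\<in>R. p\<^sup>2)"
  proof (rule sum.cong[OF refl])
    fix e assume "e \<in> R"
    moreover obtain x y where e: "e = (x, y)"
      by (cases e)
    ultimately have "x \<noteq> y" "{x, y} \<subseteq> pverts G"
      using assms(2,3) by (auto simp: irrefl_def)
    then have "measure_pmf.prob (random_vertex_set G p) {A. {x, y} \<subseteq> A} = p\<^sup>2"
      by (subst prob_subset_random_vertex_set) (use assms in \<open>auto simp: power2_eq_square\<close>)
    then show "(case e of (x, y) \<Rightarrow> measure_pmf.prob (random_vertex_set G p) {A. {x, y} \<subseteq> A}) = p\<^sup>2"
      by (simp only: e prod.case)
  qed
  also have "\<dots> = card R * p\<^sup>2"
    by simp
  finally show ?thesis
    unfolding eq .
qed

text \<open>Second moment method. The \<open>p ^ 4\<close> terms add up to the squared mean and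
  cancel the \<open>- 1\<close> of the variance bound. For a fixed pair, only the pair itself and
  its reversal share both vertices with it, which gives the first summand; coincidences of single
  vertices number at most \<open>4 * d\<close> and give the second.\<close>

lemma prob_contains_no_pair_le:
  fixes p :: real
  assumes "finite (pverts G)" "R \<subseteq> pverts G \<times> pverts G" "irrefl R" "sym R"
    and deg: "\<And>x. x \<in> pverts G \<Longrightarrow> card (R `` {x}) = d"
    and "R \<noteq> {}" "0 < p" "p \<le> 1"
  shows "measure_pmf.prob (random_vertex_set G p) {A. \<not> (\<exists>(x, y)\<in>R. x \<in> A \<and> y \<in> A)} \<le>
    2 / (card R * p\<^sup>2) + 4 * real d / (card R * p)"
proof -
  let ?M = "random_vertex_set G p"
  let ?m = "real (card R)"
  define S where "S e = {A. {fst e, snd e} \<subseteq> A}" for e :: "'a \<times> 'a"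
  have fin: "finite R"
    using assms(1,2) by (auto intro: finite_subset)
  have m: "?m > 0"
    using fin \<open>R \<noteq> {}\<close> by (simp add: card_gt_0_iff)
  have prob1: "measure_pmf.prob ?M (S e) = p\<^sup>2" if "e \<in> R" for e
  proof -
    have "fst e \<noteq> snd e" "{fst e, snd e} \<subseteq> pverts G"
      using that assms(2,3) by (cases e; auto simp: irrefl_def)+
    then show ?thesis
      unfolding S_def using assms(1,7,8)
      by (subst prob_subset_random_vertex_set) (auto simp: power2_eq_square)
  qed
  \<comment> \<open>The degree hypothesis concerns first coordinates; symmetry of \<open>R\<close>
    transfers it to second coordinates.\<close>
  have row: "(\<Sum>f\<in>R. of_bool (fst f = x)) = real d"
    and col: "(\<Sum>f\<in>R. of_bool (snd f = x)) = real d" if "x \<in> pverts G" for x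
  proof -
    have "card {f \<in> R. fst f = x} = card (R `` {x})"
      by (rule bij_betw_same_card[of snd])
        (auto simp: bij_betw_def inj_on_def image_iff intro: rev_bexI)
    moreover have "card {f \<in> R. snd f = x} = card (R `` {x})"
      by (rule bij_betw_same_card[of fst])
        (use \<open>sym R\<close> in \<open>auto simp: bij_betw_def inj_on_def image_iff sym_def intro: rev_bexI\<close>)
    ultimately show "(\<Sum>f\<in>R. of_bool (fst f = x)) = real d" "(\<Sum>f\<in>R. of_bool (snd f = x)) = real d"
      using deg[OF that] fin by (simp_all add: of_bool_def sum.If_cases Int_def)
  qed
  have diag: "(\<Sum>f\<in>R. of_bool (f = e)) \<le> (1 :: real)" for e
    using fin by (simp add: of_bool_def)
  \<comment> \<open>\<open>{x, y, z, w}\<close> has 4, 3 or 2 elements, depending on how many vertices the pairs share.\<close>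
  have prob2: "measure_pmf.prob ?M (S (x, y) \<inter> S (z, w)) \<le>
      p ^ 4 + p ^ 3 * (of_bool (z = x) + of_bool (z = y) + of_bool (w = x) + of_bool (w = y))
      + p\<^sup>2 * (of_bool ((z, w) = (x, y)) + of_bool ((z, w) = (y, x)))"
    if "(x, y) \<in> R" "(z, w) \<in> R" for x y z w
  proof -
    have ne: "x \<noteq> y" "z \<noteq> w" and sub: "{x, y, z, w} \<subseteq> pverts G"
      using that assms(2,3) by (auto simp: irrefl_def)
    have "S (x, y) \<inter> S (z, w) = {A. {x, y, z, w} \<subseteq> A}"
      by (auto simp: S_def)
    then have "measure_pmf.prob ?M (S (x, y) \<inter> S (z, w)) = p ^ card {x, y, z, w}"
      by (simp only:) (subst prob_subset_random_vertex_set, use sub assms in auto)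
    also have "card {x, y, z, w} = 4 - of_bool (z \<in> {x, y}) - of_bool (w \<in> {x, y})"
      using ne by (auto simp: card_insert_if)
    finally show ?thesis
      using ne \<open>0 < p\<close> by (auto simp: power2_eq_square numeral_eq_Suc split: if_splits)
  qed
  have inner: "(\<Sum>f\<in>R. measure_pmf.prob ?M (S e \<inter> S f)) \<le> ?m * p ^ 4 + 4 * real d * p ^ 3 + 2 * p\<^sup>2"
    if "e \<in> R" for e
  proof -
    obtain x y where e: "e = (x, y)" by (cases e)
    have xy: "x \<in> pverts G" "y \<in> pverts G"
      using that e assms(2) by auto
    have "(\<Sum>f\<in>R. measure_pmf.prob ?M (S e \<inter> S f)) \<le> (\<Sum>f\<in>R. p ^ 4 +
        p ^ 3 * (of_bool (fst f = x) + of_bool (fst f = y) + of_bool (snd f = x) + of_bool (snd f = y))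
        + p\<^sup>2 * (of_bool (f = (x, y)) + of_bool (f = (y, x))))"
    proof (rule sum_mono)
      fix f assume "f \<in> R"
      then show "measure_pmf.prob ?M (S e \<inter> S f) \<le> p ^ 4 +
        p ^ 3 * (of_bool (fst f = x) + of_bool (fst f = y) + of_bool (snd f = x) + of_bool (snd f = y))
        + p\<^sup>2 * (of_bool (f = (x, y)) + of_bool (f = (y, x)))"
        using prob2[of x y "fst f" "snd f"] that by (simp only: e prod.collapse)
    qed
    also have "\<dots> = ?m * p ^ 4 + p ^ 3 * (4 * real d)
        + p\<^sup>2 * ((\<Sum>f\<in>R. of_bool (f = (x, y))) + (\<Sum>f\<in>R. of_bool (f = (y, x))))"
      by (simp add: sum.distrib row col xy flip: sum_distrib_left)
    also have "\<dots> \<le> ?m * p ^ 4 + p ^ 3 * (4 * real d) + p\<^sup>2 * (1 + 1)"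
      by (intro add_mono mult_left_mono diag order_refl) auto
    finally show ?thesis by (simp add: mult_ac)
  qed
  have "{A. \<not> (\<exists>(x, y)\<in>R. x \<in> A \<and> y \<in> A)} = {A. \<forall>e\<in>R. A \<notin> S e}"
    by (auto simp: S_def)
  also have "measure_pmf.prob ?M \<dots> \<le>
      (\<Sum>e\<in>R. \<Sum>f\<in>R. measure_pmf.prob ?M (S e \<inter> S f)) / (?m * p\<^sup>2)\<^sup>2 - 1"
  proof (rule prob_avoid_le_second_moment)
    show "finite (set_pmf ?M)"
      using assms(1) by (intro finite_subset[OF set_pmf_random_vertex_set]) simp
  qed (use m \<open>0 < p\<close> prob1 in auto)
  also have "\<dots> \<le> (\<Sum>e\<in>R. ?m * p ^ 4 + 4 * real d * p ^ 3 + 2 * p\<^sup>2) / (?m * p\<^sup>2)\<^sup>2 - 1"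
    by (intro diff_right_mono divide_right_mono sum_mono inner) auto
  also have "\<dots> = 2 / (?m * p\<^sup>2) + 4 * real d / (?m * p)"
    using m \<open>0 < p\<close> by (simp add: field_simps power2_eq_square numeral_eq_Suc)
  finally show ?thesis .
qed

section \<open>Bootstrap percolation\<close>

lemma bootstrap_mono: "i \<le> j \<Longrightarrow> bootstrap G r A i \<subseteq> bootstrap G r A j"
  by (rule lift_Suc_mono_le[of "bootstrap G r A"]) auto

lemma bootstrap_subset: "A \<subseteq> pverts G \<Longrightarrow> bootstrap G r A i \<subseteq> pverts G"
  by (induction i) auto

text \<open>Forgetting the infection times lets the arguments below chain infections without
  tracking rounds.\<close>

definition bootstrap_closure :: "'a pair_pre_digraph \<Rightarrow> nat \<Rightarrow> 'a set \<Rightarrow> 'a set" where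
  "bootstrap_closure G r A = (\<Union>i. bootstrap G r A i)"

lemma subset_bootstrap_closure: "A \<subseteq> bootstrap_closure G r A"
  unfolding bootstrap_closure_def using bootstrap.simps(1)[of G r A] by blast

text \<open>Rounds increase, so vertices infected at different times are both present in the later
  round. Finiteness is needed for \<open>card\<close> to count them.\<close>

lemma bootstrap_closure_step:
  assumes "finite (pverts G)" "A \<subseteq> pverts G" "v \<in> pverts G"
    and "(v, x) \<in> parcs G" "(v, y) \<in> parcs G" "x \<noteq> y"
    and "x \<in> bootstrap_closure G 2 A" "y \<in> bootstrap_closure G 2 A"
  shows "v \<in> bootstrap_closure G 2 A"
proof -
  obtain i j where ij: "x \<in> bootstrap G 2 A i" "y \<in> bootstrap G 2 A j"
    using assms by (auto simp: bootstrap_closure_def)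
  let ?B = "bootstrap G 2 A (max i j)"
  have "{x, y} \<subseteq> neighborhood G v \<inter> ?B"
    using ij bootstrap_mono[of i "max i j" G 2 A] bootstrap_mono[of j "max i j" G 2 A] assms(4,5)
    by (auto simp: neighborhood_def)
  moreover have "finite ?B"
    using assms(1,2) bootstrap_subset finite_subset by metis
  ultimately have "2 \<le> card (neighborhood G v \<inter> ?B)"
    using card_mono[of "neighborhood G v \<inter> ?B" "{x, y}"] \<open>x \<noteq> y\<close> by simp
  then have "v \<in> bootstrap G 2 A (Suc (max i j))"
    using assms(3) by simp
  then show ?thesis
    unfolding bootstrap_closure_def by blast
qed

text \<open>Every vertex has an infection time, and on a finite vertex set these times have a
  maximum.\<close>

lemma percolatesI_closure:
  assumes "finite (pverts G)" "A \<subseteq> pverts G" "pverts G \<subseteq> bootstrap_closure G r A"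
  shows "percolates G r A"
proof -
  have "\<forall>v\<in>pverts G. \<exists>i. v \<in> bootstrap G r A i"
    using assms(3) by (auto simp: bootstrap_closure_def)
  then obtain i where i: "v \<in> bootstrap G r A (i v)" if "v \<in> pverts G" for v
    by metis
  have "v \<in> bootstrap G r A (Max (i ` pverts G))" if "v \<in> pverts G" for v
    using i[OF that] bootstrap_mono[of "i v" "Max (i ` pverts G)" G r A] that assms(1) by auto
  then have "bootstrap G r A (Max (i ` pverts G)) = pverts G"
    using bootstrap_subset[OF assms(2)] by blast
  then show ?thesis
    unfolding percolates_def by blast
qed

text \<open>If no vertex had two neighbors in \<open>A\<close>, the process would be stuck at
  \<open>A\<close>, which would then have to be the whole vertex set.\<close>

lemma percolates_obtains_two_neighbors:
  assumes "percolates G 2 A" "A \<noteq> pverts G"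
  obtains v x y where "x \<in> A" "y \<in> A" "x \<noteq> y" "(v, x) \<in> parcs G" "(v, y) \<in> parcs G"
proof -
  have "\<exists>v x y. x \<in> A \<and> y \<in> A \<and> x \<noteq> y \<and> (v, x) \<in> parcs G \<and> (v, y) \<in> parcs G"
  proof (rule ccontr)
    assume none: "\<not> ?thesis"
    have small: "card (neighborhood G v \<inter> A) < 2" for v
    proof (rule ccontr)
      assume "\<not> ?thesis"
      then obtain T where "T \<subseteq> neighborhood G v \<inter> A" "card T = 2"
        by (meson not_less obtain_subset_with_card_n)
      then obtain x y where "x \<noteq> y" "{x, y} \<subseteq> neighborhood G v \<inter> A"
        by (auto simp: card_2_iff)
      then show False
        using none unfolding neighborhood_def by blast
    qed
    have "bootstrap G 2 A i = A" for i
      by (induction i) (use small in \<open>auto simp: not_le[symmetric]\<close>)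
    then show False
      using assms by (auto simp: percolates_def)
  qed
  then show ?thesis using that by blast
qed

section \<open>The Hamming cube\<close>

text \<open>Bitwise exclusive or with the indicator of \<open>D\<close>. Recentering the cube at
  \<open>x\<close> turns vertices into subsets of \<open>{..<n}\<close> and Hamming distance into
  the size of a symmetric difference.\<close>

definition flip :: "bool list \<Rightarrow> nat set \<Rightarrow> bool list" where
  "flip x D = map (\<lambda>i. x ! i \<noteq> (i \<in> D)) [0..<length x]"

lemma flip_in_cube: "x \<in> cube n \<Longrightarrow> flip x D \<in> cube n"
  by (simp add: flip_def cube_def)

lemma hamming_dist_flip:
  assumes "x \<in> cube n" "D \<subseteq> {..<n}" "E \<subseteq> {..<n}"
  shows "hamming_dist (flip x D) (flip x E) = card (sym_diff D E)"
  unfolding hamming_dist_def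
  by (rule arg_cong[where f = card]) (use assms in \<open>auto simp: flip_def cube_def\<close>)

lemma flip_empty [simp]: "flip x {} = x"
  by (auto simp: flip_def intro: nth_equalityI)

lemma hamming_dist_flip_right:
  assumes "x \<in> cube n" "D \<subseteq> {..<n}"
  shows "hamming_dist x (flip x D) = card D"
  using hamming_dist_flip[OF assms(1) _ assms(2), of "{}"] by simp

lemma bij_betw_flip:
  assumes "x \<in> cube n"
  shows "bij_betw (flip x) (Pow {..<n}) (cube n)"
proof (rule bij_betw_byWitness[where f' = "\<lambda>y. {i. i < n \<and> x ! i \<noteq> y ! i}"])
  show "\<forall>y\<in>cube n. flip x {i. i < n \<and> x ! i \<noteq> y ! i} = y"
    using assms by (auto simp: flip_def cube_def intro!: nth_equalityI)
qed (use assms in \<open>auto simp: flip_def cube_def\<close>)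

lemma cube_eq_flipE:
  assumes "x \<in> cube n" "y \<in> cube n"
  obtains D where "D \<subseteq> {..<n}" "y = flip x D"
  using assms bij_betw_imp_surj_on[OF bij_betw_flip[OF assms(1)]] by blast

lemma hamming_dist_triangle:
  assumes "length x = length y" "length y = length z"
  shows "hamming_dist x z \<le> hamming_dist x y + hamming_dist y z"
proof -
  have "{i. i < length x \<and> x ! i \<noteq> z ! i} \<subseteq>
      {i. i < length x \<and> x ! i \<noteq> y ! i} \<union> {i. i < length y \<and> y ! i \<noteq> z ! i}"
    using assms by auto
  then show ?thesis
    unfolding hamming_dist_def by (intro order_trans[OF card_mono card_Un_le]) auto
qed

lemma hamming_dist_eq_0_iff: "length x = length y \<Longrightarrow> hamming_dist x y = 0 \<longleftrightarrow> x = y"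
  by (auto simp: hamming_dist_def intro: nth_equalityI)

lemma card_cube: "card (cube n) = 2 ^ n"
  using card_lists_length_eq[of "UNIV :: bool set" n] by (simp add: cube_def)

lemma card_sphere:
  assumes "x \<in> cube n"
  shows "card {y \<in> cube n. hamming_dist x y = j} = n choose j"
proof -
  have "bij_betw (flip x) {D \<in> Pow {..<n}. card D = j} {y \<in> cube n. hamming_dist x y = j}"
    by (rule bij_betw_Collect[OF bij_betw_flip[OF assms]])
      (simp add: hamming_dist_flip_right[OF assms])
  from bij_betw_same_card[OF this] n_subsets[of "{..<n}" j] show ?thesis
    by (simp add: Pow_def Collect_conj_eq)
qed

section \<open>Counting pairs at prescribed distances\<close>

definition dist_pairs :: "nat \<Rightarrow> nat set \<Rightarrow> (bool list \<times> bool list) set" where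
  "dist_pairs n J = {(x, y). x \<in> cube n \<and> y \<in> cube n \<and> hamming_dist x y \<in> J}"

lemma dist_pairs_subset: "dist_pairs n J \<subseteq> cube n \<times> cube n"
  by (auto simp: dist_pairs_def)

lemma irrefl_dist_pairs: "0 \<notin> J \<Longrightarrow> irrefl (dist_pairs n J)"
  by (auto simp: irrefl_def dist_pairs_def hamming_dist_def)

lemma sym_dist_pairs: "sym (dist_pairs n J)"
  by (auto simp: sym_def dist_pairs_def cube_def hamming_dist_sym)

text \<open>The image is a union of spheres around \<open>x\<close>, disjoint for different radii.
  This supplies the common degree for the second moment method.\<close>

lemma card_dist_pairs_Image:
  assumes "finite J" "x \<in> cube n"
  shows "card (dist_pairs n J `` {x}) = (\<Sum>j\<in>J. n choose j)"
proof -
  have "dist_pairs n J `` {x} = (\<Union>j\<in>J. {y \<in> cube n. hamming_dist x y = j})"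
    using assms by (auto simp: dist_pairs_def)
  also have "card \<dots> = (\<Sum>j\<in>J. card {y \<in> cube n. hamming_dist x y = j})"
    using assms by (intro card_UN_disjoint) (auto simp: finite_cube)
  finally show ?thesis
    using assms by (simp add: card_sphere)
qed

lemma card_dist_pairs:
  assumes "finite J"
  shows "card (dist_pairs n J) = 2 ^ n * (\<Sum>j\<in>J. n choose j)"
proof -
  have "dist_pairs n J = (SIGMA x:cube n. dist_pairs n J `` {x})"
    by (auto simp: dist_pairs_def)
  also have "card \<dots> = (\<Sum>x\<in>cube n. card (dist_pairs n J `` {x}))"
    using finite_subset[OF dist_pairs_subset] by (intro card_SigmaI) (auto simp: finite_cube)
  finally show ?thesis
    using assms by (simp add: card_dist_pairs_Image card_cube)
qed

section \<open>Percolation on the Hamming cube\<close>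

lemma pverts_Q [simp]: "pverts (Q n k) = cube n"
  by (simp add: Q_def)

text \<open>A first new infection needs a vertex adjacent to two members of \<open>A\<close>, and
  these are within \<open>2 * k\<close> of each other by the triangle inequality.\<close>

lemma close_pair_if_percolates_Q:
  assumes "percolates (Q n k) 2 A" "A \<subseteq> cube n" "n \<ge> 1" "k \<ge> 1"
  shows "\<exists>(x, y)\<in>dist_pairs n {1..2 * k}. x \<in> A \<and> y \<in> A"
proof (cases "A = cube n")
  case True
  \<comment> \<open>The full cube needs no new infection, so a close pair is exhibited directly;
    coordinate \<open>0\<close> exists because \<open>n \<ge> 1\<close>.\<close>
  define x where "x = replicate n False"
  have x: "x \<in> cube n"
    by (simp add: x_def cube_def)
  have "hamming_dist x (flip x {0}) = 1"
    using hamming_dist_flip_right[OF x, of "{0}"] \<open>n \<ge> 1\<close> by simp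
  then have "(x, flip x {0}) \<in> dist_pairs n {1..2 * k}"
    using x flip_in_cube[OF x] \<open>k \<ge> 1\<close> by (simp add: dist_pairs_def)
  then show ?thesis
    using True x flip_in_cube[OF x] by blast
next
  case False
  then obtain v x y where *: "x \<in> A" "y \<in> A" "x \<noteq> y" "(v, x) \<in> parcs (Q n k)" "(v, y) \<in> parcs (Q n k)"
    using percolates_obtains_two_neighbors[OF assms(1)] by (metis pverts_Q)
  then have len: "length v = n" "length x = n" "length y = n"
    and d: "hamming_dist v x \<le> k" "hamming_dist v y \<le> k"
    by (auto simp: Q_def cube_def)
  have "hamming_dist x y \<le> 2 * k"
    using hamming_dist_triangle[of x v y] hamming_dist_sym[of x v] len d by simp
  moreover have "hamming_dist x y \<noteq> 0"
    using hamming_dist_eq_0_iff[of x y] len * by simp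
  ultimately have "(x, y) \<in> dist_pairs n {1..2 * k}"
    using len by (simp add: dist_pairs_def cube_def)
  then show ?thesis using * by blast
qed

text \<open>The infection rule in the language of subsets. \<open>F\<close> has to differ from
  \<open>S\<close> and \<open>T\<close> because no vertex is its own neighbor.\<close>

lemma bootstrap_closure_Q_step:
  assumes A: "A \<subseteq> cube n" and x: "x \<in> cube n"
    and sub: "F \<subseteq> {..<n}" "S \<subseteq> {..<n}" "T \<subseteq> {..<n}"
    and ne: "S \<noteq> T" "F \<noteq> S" "F \<noteq> T"
    and near: "card (sym_diff F S) \<le> k" "card (sym_diff F T) \<le> k"
    and infected: "flip x S \<in> bootstrap_closure (Q n k) 2 A" "flip x T \<in> bootstrap_closure (Q n k) 2 A"
  shows "flip x F \<in> bootstrap_closure (Q n k) 2 A"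
proof -
  have arc: "(flip x F, flip x E) \<in> parcs (Q n k)"
    if "E \<subseteq> {..<n}" "F \<noteq> E" "card (sym_diff F E) \<le> k" for E
  proof -
    have "finite (sym_diff F E)"
      using that(1) sub(1) by (meson finite_Diff finite_UnI finite_lessThan finite_subset)
    moreover have "sym_diff F E \<noteq> {}"
      using that(2) by blast
    ultimately have "1 \<le> card (sym_diff F E)"
      by (simp add: card_gt_0_iff Suc_le_eq del: Un_empty)
    then show ?thesis
      using that(3) hamming_dist_flip[OF x sub(1) that(1)]
      by (simp add: Q_def flip_in_cube[OF x])
  qed
  have "flip x S \<noteq> flip x T"
    using inj_on_eq_iff[OF bij_betw_imp_inj_on[OF bij_betw_flip[OF x]], of S T] sub ne by simp
  then show ?thesis
    using bootstrap_closure_step[OF _ _ _ arc arc _ infected] A flip_in_cube[OF x] sub ne near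
    by (simp add: finite_cube)
qed

text \<open>A vertex at distance \<open>m \<ge> 2\<close> from \<open>u\<close> has \<open>m\<close> neighbors at distance \<open>m - 1\<close> from \<open>u\<close>, so
  an infected unit ball grows one layer at a time.\<close>

lemma unit_ball_percolates_Q:
  assumes "k \<ge> 1" "A \<subseteq> cube n" "u \<in> cube n"
    and ball: "\<And>D. D \<subseteq> {..<n} \<Longrightarrow> card D \<le> 1 \<Longrightarrow> flip u D \<in> bootstrap_closure (Q n k) 2 A"
  shows "percolates (Q n k) 2 A"
proof (rule percolatesI_closure)
  have "flip u D \<in> bootstrap_closure (Q n k) 2 A" if "D \<subseteq> {..<n}" for D
    using that
  proof (induction "card D" arbitrary: D rule: less_induct)
    case less
    have fin: "finite D"
      using less.prems finite_subset by blast
    show ?case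
    proof (cases "card D \<le> 1")
      case False
      then obtain a b where ab: "a \<in> D" "b \<in> D" "a \<noteq> b"
        by (metis card_le_Suc0_iff_eq fin One_nat_def)
      have IH: "flip u (D - {c}) \<in> bootstrap_closure (Q n k) 2 A" if "c \<in> D" for c
        using that less.prems card_Diff1_less[OF fin that] by (intro less.hyps) auto
      have near: "card (sym_diff D (D - {c})) \<le> k" if "c \<in> D" for c
      proof -
        have "sym_diff D (D - {c}) = {c}"
          using that by auto
        then show ?thesis
          using assms(1) by simp
      qed
      show ?thesis
        using IH[OF ab(1)] IH[OF ab(2)] near[OF ab(1)] near[OF ab(2)] ab less.prems
        by (intro bootstrap_closure_Q_step[OF assms(2,3), of D "D - {a}" "D - {b}"]) blast+
    qed (use ball less.prems in blast)
  qed
  then show "pverts (Q n k) \<subseteq> bootstrap_closure (Q n k) 2 A"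
    using cube_eq_flipE[OF assms(3)] by (metis pverts_Q subsetI)
qed (use assms finite_cube in auto)

text \<open>Put the two vertices at \<open>x\<close> and \<open>flip x D\<close> with \<open>card D = 2 * k\<close>. All \<open>k\<close>-subsets of \<open>D\<close> are
  infected; two of them of the form \<open>insert a U\<close>, \<open>insert b U\<close> infect the unit ball around \<open>U\<close>.\<close>

lemma percolates_Q_if_pair:
  assumes "k \<ge> 2" "A \<subseteq> cube n" "x \<in> A" "y \<in> A" "hamming_dist x y = 2 * k"
  shows "percolates (Q n k) 2 A"
proof -
  let ?C = "bootstrap_closure (Q n k) 2 A"
  have x: "x \<in> cube n" and y: "y \<in> cube n"
    using assms by auto
  obtain D where D: "D \<subseteq> {..<n}" "y = flip x D"
    using cube_eq_flipE[OF x y] .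
  have finD: "finite D" and cardD: "card D = 2 * k"
    using D finite_subset assms(5) hamming_dist_flip_right[OF x D(1)] by auto
  have "x \<in> ?C" "y \<in> ?C"
    using assms(3,4) subset_bootstrap_closure[of A] by blast+
  \<comment> \<open>Such an \<open>S\<close> is at distance \<open>k\<close> from both
    \<open>{}\<close> and \<open>D\<close>, which stand for \<open>x\<close> and
    \<open>y\<close>.\<close>
  have mid: "flip x S \<in> ?C" if "S \<subseteq> D" "card S = k" for S
  proof (rule bootstrap_closure_Q_step[OF assms(2) x, where S = "{}" and T = D])
    have "sym_diff S D = D - S"
      using that by auto
    then show "card (sym_diff S D) \<le> k"
      using that cardD finD by (simp add: card_Diff_subset finite_subset)
  qed (use that D \<open>x \<in> ?C\<close> \<open>y \<in> ?C\<close> cardD assms(1) in auto)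
  obtain U where U: "U \<subseteq> D" "card U = k - 1"
  proof -
    have "k - 1 \<le> card D"
      using cardD by simp
    then show thesis
      using that by (rule obtain_subset_with_card_n)
  qed
  have finU: "finite U"
    using U finD finite_subset by blast
  have "card (D - U) = k + 1"
    using U finU cardD assms(1) by (simp add: card_Diff_subset)
  then obtain a b where ab: "a \<in> D - U" "b \<in> D - U" "a \<noteq> b"
    using assms(1) by (metis One_nat_def add_le_same_cancel2 card_le_Suc0_iff_eq card.infinite
        le_add2 le_zero_eq not_numeral_le_zero)
  have S: "flip x (insert c U) \<in> ?C" if "c \<in> D - U" for c
    using that U finU assms(1) by (intro mid) auto
  have "flip (flip x U) E \<in> ?C" if E: "E \<subseteq> {..<n}" "card E \<le> 1" for E
  proof -
    have finE: "finite E"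
      using E finite_subset by blast
    \<comment> \<open>Flips compose by symmetric difference, so the unit ball around
      \<open>U\<close> consists of the sets \<open>sym_diff U E\<close>.\<close>
    have eq: "flip (flip x U) E = flip x (sym_diff U E)"
      using x by (auto simp: flip_def cube_def)
    \<comment> \<open>Going from \<open>sym_diff U E\<close> to \<open>insert c U\<close> changes at
      most \<open>c\<close> and the single element of \<open>E\<close>. This distance of up to 2 is
      why \<open>k \<ge> 2\<close> is assumed.\<close>
    have near: "card (sym_diff (sym_diff U E) (insert c U)) \<le> k" if "c \<in> D - U" for c
    proof -
      have "sym_diff (sym_diff U E) (insert c U) \<subseteq> insert c E"
        by auto
      then have "card (sym_diff (sym_diff U E) (insert c U)) \<le> card (insert c E)"
        using finE by (intro card_mono) auto
      also have "\<dots> \<le> 2"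
        using E finE by (simp add: card_insert_if)
      finally show ?thesis
        using assms(1) by simp
    qed
    show ?thesis
    \<comment> \<open>If the target coincides with one of the two infecting sets, the infection rule
      does not apply, but the target is already infected.\<close>
    proof (cases "sym_diff U E = insert a U \<or> sym_diff U E = insert b U")
      case True
      then show ?thesis using S ab eq by auto
    next
      case False
      then have ne: "sym_diff U E \<noteq> insert a U" "sym_diff U E \<noteq> insert b U"
        by blast+
      have "insert a U \<noteq> insert b U"
        using ab by blast
      moreover have "sym_diff U E \<subseteq> {..<n}" "insert a U \<subseteq> {..<n}" "insert b U \<subseteq> {..<n}"
        using U(1) D(1) E(1) ab by blast+
      ultimately show ?thesis
        unfolding eq by (intro bootstrap_closure_Q_step[OF assms(2) x _ _ _ _ ne] near S ab(1,2))
    qed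
  qed
  then show ?thesis
    using assms x by (intro unit_ball_percolates_Q[where u = "flip x U"]) (auto simp: flip_in_cube)
qed

section \<open>First and second moment bounds on the cube\<close>

lemma prob_percolates_Q_le:
  fixes p :: real
  assumes "n \<ge> 1" "k \<ge> 1" "0 \<le> p" "p \<le> 1"
  shows "measure_pmf.prob (random_vertex_set (Q n k) p) {A. percolates (Q n k) 2 A} \<le>
    2 ^ n * (2 * real k * real n ^ (2 * k)) * p\<^sup>2"
proof -
  let ?M = "random_vertex_set (Q n k) p" and ?R = "dist_pairs n {1..2 * k}"
  have "measure_pmf.prob ?M {A. percolates (Q n k) 2 A} \<le>
      measure_pmf.prob ?M {A. \<exists>(x, y)\<in>?R. x \<in> A \<and> y \<in> A}"
    using close_pair_if_percolates_Q assms set_pmf_random_vertex_set[of "Q n k" p]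
    by (intro measure_pmf.finite_measure_mono_AE) (auto simp: AE_measure_pmf_iff)
  also have "\<dots> \<le> card ?R * p\<^sup>2"
    using assms
    by (intro prob_contains_pair_le irrefl_dist_pairs) (auto simp: finite_cube dist_pairs_def)
  \<comment> \<open>A crude uniform bound suffices: the number of distances contributes only the
    constant factor \<open>2 * k\<close>.\<close>
  also have "(\<Sum>j\<in>{1..2 * k}. n choose j) \<le> (\<Sum>j\<in>{1..2 * k}. n ^ (2 * k))"
  proof (rule sum_mono)
    fix j assume j: "j \<in> {1..2 * k}"
    have "n choose j \<le> n ^ j"
      by (cases "j \<le> n") (auto intro: binomial_le_pow simp: binomial_eq_0)
    also have "\<dots> \<le> n ^ (2 * k)"
      using j assms by (intro power_increasing) auto
    finally show "n choose j \<le> n ^ (2 * k)" .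
  qed
  then have "card ?R \<le> 2 ^ n * (2 * k * n ^ (2 * k))"
    by (simp add: card_dist_pairs)
  then have "real (card ?R) * p\<^sup>2 \<le> real (2 ^ n * (2 * k * n ^ (2 * k))) * p\<^sup>2"
    by (intro mult_right_mono) (simp_all only: of_nat_le_iff zero_le_power2)
  finally show ?thesis by simp
qed

text \<open>Second moment method for pairs at distance exactly \<open>2 * k\<close>. The number of
  pairs is \<open>2 ^ n\<close> times the degree, so the degree cancels in the second error term; in
  the first it is bounded below by \<open>(n / (2 * k)) ^ (2 * k)\<close>.\<close>

lemma prob_percolates_Q_ge:
  fixes p :: real
  assumes "k \<ge> 2" "2 * k \<le> n" "0 < p" "p \<le> 1"
  shows "measure_pmf.prob (random_vertex_set (Q n k) p) {A. percolates (Q n k) 2 A} \<ge>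
    1 - (2 * (2 * real k) ^ (2 * k) / (2 ^ n * real n ^ (2 * k) * p\<^sup>2) + 4 / (2 ^ n * p))"
proof -
  let ?M = "random_vertex_set (Q n k) p" and ?R = "dist_pairs n {2 * k}"
  let ?d = "n choose (2 * k)"
  have d: "?d > 0"
    using assms by simp
  have cardR: "card ?R = 2 ^ n * ?d"
    by (simp add: card_dist_pairs)
  have "1 - measure_pmf.prob ?M {A. percolates (Q n k) 2 A} =
      measure_pmf.prob ?M {A. \<not> percolates (Q n k) 2 A}"
    using measure_pmf.prob_compl[of "{A. percolates (Q n k) 2 A}" ?M] 
    by (simp add: Collect_neg_eq Compl_eq_Diff_UNIV)
  also have "\<dots> \<le> measure_pmf.prob ?M {A. \<not> (\<exists>(x, y)\<in>?R. x \<in> A \<and> y \<in> A)}"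
    using percolates_Q_if_pair assms set_pmf_random_vertex_set[of "Q n k" p]
    by (intro measure_pmf.finite_measure_mono_AE) (auto simp: AE_measure_pmf_iff dist_pairs_def)
  also have "\<dots> \<le> 2 / (card ?R * p\<^sup>2) + 4 * real ?d / (card ?R * p)"
  proof (rule prob_contains_no_pair_le)
    show "?R \<noteq> {}"
      using cardR d by auto
  qed (use assms card_dist_pairs_Image[of "{2 * k}" _ n] in
      \<open>auto simp: finite_cube irrefl_dist_pairs sym_dist_pairs dist_pairs_subset\<close>)
  also have "4 * real ?d / (card ?R * p) = 4 / (2 ^ n * p)"
    using d by (simp add: cardR)
  also have "2 / (card ?R * p\<^sup>2) \<le> 2 / (2 ^ n * (n / (2 * k)) ^ (2 * k) * p\<^sup>2)"
  proof (rule divide_left_mono)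
    have "(real n / real (2 * k)) ^ (2 * k) \<le> ?d"
      by (rule binomial_ge_n_over_k_pow_k) (use assms in auto)
    then show "2 ^ n * (n / (2 * k)) ^ (2 * k) * p\<^sup>2 \<le> card ?R * p\<^sup>2"
      by (simp add: cardR mult_right_mono)
  qed (use assms d cardR in auto)
  also have "\<dots> = 2 * (2 * real k) ^ (2 * k) / (2 ^ n * real n ^ (2 * k) * p\<^sup>2)"
    using assms by (simp add: power_divide)
  finally show ?thesis by simp
qed

section \<open>Locating the critical probability\<close>

theorem theorem2p3:
  fixes k :: nat and \<omega> :: "nat \<Rightarrow> real"
  assumes "k \<ge> 2"
    and "filterlim \<omega> at_top sequentially"
  shows "\<forall>\<^sub>F n in sequentially.
           1 / \<omega> n * 2 powr (- real n / 2) * real n powr (- real k) \<le> critical_prob (Q n k) 2 \<and>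
           critical_prob (Q n k) 2 \<le> \<omega> n * 2 powr (- real n / 2) * real n powr (- real k)"
proof -
  \<comment> \<open>The first entry makes the first moment bound at most 1/2. The second makes the
    leading second moment error less than 1/4, with \<open>+ 1\<close> providing strictness.\<close>
  define c where "c = max (real (4 * k)) (8 * (2 * real k) ^ (2 * k) + 1)"
  have "\<forall>\<^sub>F n in sequentially. \<omega> n \<ge> c"
    using assms(2) by (simp add: filterlim_at_top)
  \<comment> \<open>This quantity is \<open>1 / (2 ^ n * q)\<close> for the scale \<open>q\<close>
    below; the bound 1/16 brings the second error term \<open>4 / (2 ^ n * p)\<close> below 1/4 when
    \<open>p \<ge> q\<close>.\<close>
  moreover have "\<forall>\<^sub>F n in sequentially. 2 powr (- real n / 2) * real n powr real k < 1 / 16"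
  proof -
    have "(\<lambda>n. 2 powr (- real n / 2) * real n powr real k) \<longlonglongrightarrow> 0"
      by real_asymp
    then show ?thesis
      by (rule order_tendstoD) simp
  qed
  moreover have "\<forall>\<^sub>F n in sequentially. n \<ge> 2 * k"
    by (rule eventually_ge_at_top)
  ultimately show ?thesis
  proof eventually_elim
    case (elim n)
    \<comment> \<open>The threshold scale, normalized so that
      \<open>2 ^ n * real n ^ (2 * k) * q\<^sup>2\<close> equals 1.\<close>
    define q where "q = 2 powr (- real n / 2) * real n powr (- real k)"
    have n: "n \<ge> 1"
      using elim(3) assms(1) by simp
    have q: "q > 0"
      using n by (simp add: q_def)
    have \<omega>: "\<omega> n \<ge> 4 * k" "\<omega> n \<ge> 8 * (2 * real k) ^ (2 * k) + 1" "\<omega> n \<ge> 1"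
      using elim(1) assms(1) by (auto simp: c_def)
    have q2: "2 ^ n * real n ^ (2 * k) * q\<^sup>2 = 1"
    proof -
      have "(2 powr (- real n / 2))\<^sup>2 = 2 powr (- real n)"
        by (simp add: power2_eq_square flip: powr_add)
      moreover have "(real n powr (- real k))\<^sup>2 = real n powr (- real (2 * k))"
        by (simp add: power2_eq_square flip: powr_add)
      ultimately show ?thesis
        using n by (simp add: q_def power_mult_distrib powr_minus powr_realpow divide_simps del: of_nat_mult)
    qed
    have q1: "1 / (2 ^ n * q) = 2 powr (- real n / 2) * real n powr real k"
    proof -
      have "(2 :: real) ^ n = 2 powr (real n / 2) * 2 powr (real n / 2)"
        by (simp add: powr_realpow flip: powr_add)
      then show ?thesis
        using n by (simp add: q_def powr_minus field_simps)
    qed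
    have "q\<^sup>2 * 1 \<le> q\<^sup>2 * (2 ^ n * real n ^ (2 * k))"
      using n by (intro mult_left_mono) (simp_all add: mult_ge1_I)
    then have "q \<le> 1"
      using q2 by (simp add: mult_ac abs_square_le_1 abs_le_iff)
    let ?P = "\<lambda>p. measure_pmf.prob (random_vertex_set (Q n k) p) {A. percolates (Q n k) 2 A}"
    let ?X = "{p \<in> {0<..<1}. ?P p \<le> 1 / 2}"
    \<comment> \<open>Membership gives the lower bound on the supremum and also shows that
      \<open>?X\<close> is nonempty, as the upper bound requires.\<close>
    have "1 / \<omega> n * q \<in> ?X"
    proof -
      have \<omega>2: "\<omega> n \<le> (\<omega> n)\<^sup>2" "\<omega> n > 1"
        using \<omega> assms(1) by (auto simp: self_le_power)
      have p: "0 < 1 / \<omega> n * q" "1 / \<omega> n * q < 1"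
        using \<omega>2 q \<open>q \<le> 1\<close> by simp_all
      have "?P (1 / \<omega> n * q) \<le> 2 ^ n * (2 * real k * real n ^ (2 * k)) * (1 / \<omega> n * q)\<^sup>2"
        using p n assms(1) by (intro prob_percolates_Q_le) auto
      also have "\<dots> = 2 * real k * (2 ^ n * real n ^ (2 * k) * q\<^sup>2) / (\<omega> n)\<^sup>2"
        by (simp add: power_mult_distrib power_divide)
      also have "\<dots> = 2 * real k / (\<omega> n)\<^sup>2"
        by (simp only: q2 mult_1_right)
      also have "\<dots> \<le> 1 / 2"
        using \<omega> \<omega>2 by (simp add: field_simps)
      finally show ?thesis
        using p by simp
    qed
    \<comment> \<open>For any larger \<open>p\<close> both error terms are below 1/4, so the
      percolation probability strictly exceeds 1/2.\<close>
    moreover have "p \<le> \<omega> n * q" if "p \<in> ?X" for p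
    proof (rule ccontr)
      assume "\<not> ?thesis"
      then have p: "\<omega> n * q < p" "0 < p" "p < 1"
        using that by auto
      have "2 * (2 * real k) ^ (2 * k) / (2 ^ n * real n ^ (2 * k) * p\<^sup>2) < 1 / 4"
      proof -
        have "8 * (2 * real k) ^ (2 * k) < \<omega> n * 1"
          using \<omega> by simp
        also have "\<dots> \<le> \<omega> n * \<omega> n"
          using \<omega> by (intro mult_left_mono) auto
        also have "\<dots> = 2 ^ n * real n ^ (2 * k) * q\<^sup>2 * (\<omega> n)\<^sup>2"
          by (simp only: q2 power2_eq_square[of "\<omega> n"] mult_1)
        also have "\<dots> = 2 ^ n * real n ^ (2 * k) * (\<omega> n * q)\<^sup>2"
          by (simp add: power_mult_distrib)
        also have "\<dots> \<le> 2 ^ n * real n ^ (2 * k) * p\<^sup>2"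
          using p \<omega> q by (intro mult_left_mono power_mono) auto
        finally show ?thesis
          using n p by (simp add: field_simps)
      qed
      moreover have "4 / (2 ^ n * p) < 1 / 4"
      proof -
        have "1 * q \<le> \<omega> n * q"
          using \<omega> q by (intro mult_right_mono) auto
        then have "q \<le> p"
          using p by simp
        then have "4 / (2 ^ n * p) \<le> 4 * (1 / (2 ^ n * q))"
          using p q by (simp add: field_simps)
        also have "\<dots> < 1 / 4"
          using elim(2) unfolding q1 by simp
        finally show ?thesis .
      qed
      moreover have "?P p \<ge> 1 - (2 * (2 * real k) ^ (2 * k) / (2 ^ n * real n ^ (2 * k) * p\<^sup>2) + 4 / (2 ^ n * p))"
        using p assms(1) elim(3) by (intro prob_percolates_Q_ge) auto
      ultimately show False
        using that by simp
    qed
    moreover have "bdd_above ?X"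
      by (rule bdd_aboveI[of _ 1]) auto
    ultimately have "1 / \<omega> n * q \<le> Sup ?X" "Sup ?X \<le> \<omega> n * q"
      by (blast intro: cSup_upper cSup_least)+
    then show ?case
      by (simp add: critical_prob_def q_def mult.assoc)
  qed
qed

end
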